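(* Let $\mathbb{T} = [0,1)$ and let $g \in L^2(\mathbb{T})$ be such that $1/g \notin L^2(\mathbb{T})$. If there exists some point $t_0 \in \mathbb{T}$ such that the function $t \mapsto (t-t_0)/g(t)$ belongs to $L^2(\mathbb{T})$, then there does not exist any sequence $\Psi = \{\psi_n\}_{n\in\mathbb{Z}} \subseteq L^2(\mathbb{T})$ such that $(\Psi, E(g,\mathbb{Z}))$ is a reproducing pair for $L^2(\mathbb{T})$.
   Context: $L^2(\mathbb{T})$ is the space of complex-valued square-integrable functions on $[0,1)$ with Lebesgue measure. For $n\in\mathbb{Z}$, $e_n(t)=e^{2\pi i n t}$, and $E(g,\mathbb{Z})=\{g\,e_n\}_{n\in\mathbb{Z}}$, a system of weighted exponentials indexed by $\mathbb{Z}$. For a Hilbert space $\mathbb{H}$ (inner product linear in the first variable) and families $\Psi=\{\psi_i\}_{i\in I}$, $\Phi=\{\phi_i\}_{i\in I}$ in $\mathbb{H}$ with the same countable index set $I$, $(\Psi,\Phi)$ is a reproducing pair for $\mathbb{H}$ if there is a fixed ordering (enumeration) of $I$ such that, for all $f,g\in\mathbb{H}$, the partial sums of $\sum_{i\in I}\langle f,\psi_i\rangle\langle\phi_i,g\rangle$ converge with respect to that ordering, and the operator $S_{\Psi,\Phi}:\mathbb{H}\to\mathbb{H}$ weakly defined by $\langle S_{\Psi,\Phi}f,g\rangle=\sum_{i\in I}\langle f,\psi_i\rangle\langle\phi_i,g\rangle$ is bounded and boundedly invertible. *)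

theory Defs
  imports "HOL-Analysis.Analysis"
begin

section \<open>Complex Hilbert spaces\<close>

class scaleC =
  fixes scaleC :: "complex \<Rightarrow> 'a \<Rightarrow> 'a" (infixr \<open>*\<^sub>C\<close> 75)

text \<open>The inner product is linear in the first variable. The real structure
  (\<open>norm\<close>, \<open>*\<^sub>R\<close>, \<open>inner\<close>) inherited from \<^class>\<open>real_inner\<close> is the one underlying it, so
  \<open>norm x = sqrt (Re (cinner x x))\<close>.\<close>

class complex_inner = real_inner + scaleC +
  fixes cinner :: "'a \<Rightarrow> 'a \<Rightarrow> complex"
  assumes scaleC_add_right: "c *\<^sub>C (x + y) = c *\<^sub>C x + c *\<^sub>C y"
    and scaleC_add_left: "(c + d) *\<^sub>C x = c *\<^sub>C x + d *\<^sub>C x"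
    and scaleC_scaleC: "c *\<^sub>C (d *\<^sub>C x) = (c * d) *\<^sub>C x"
    and scaleC_of_real: "complex_of_real r *\<^sub>C x = r *\<^sub>R x"
    and cinner_commute: "cinner x y = cnj (cinner y x)"
    and cinner_add_left: "cinner (x + y) z = cinner x z + cinner y z"
    and cinner_scaleC_left: "cinner (c *\<^sub>C x) y = c * cinner x y"
    and Re_cinner: "Re (cinner x y) = inner x y"

class complex_hilbert = complex_inner + complete_space

definition bounded_clinear :: "('a::complex_inner \<Rightarrow> 'b::complex_inner) \<Rightarrow> bool" where
  "bounded_clinear S \<longleftrightarrow> bounded_linear S \<and> (\<forall>c x. S (c *\<^sub>C x) = c *\<^sub>C S x)"

definition boundedly_invertible :: "('a::complex_inner \<Rightarrow> 'b::complex_inner) \<Rightarrow> bool" where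
  "boundedly_invertible S \<longleftrightarrow> (\<exists>R. bounded_clinear R \<and> R \<circ> S = id \<and> S \<circ> R = id)"

text \<open>The index set is the whole, countably infinite type \<open>'i\<close>; an ordering is a bijection
  \<open>\<sigma>\<close> from the natural numbers, and \<open>sums\<close> refers to the partial sums along \<open>\<sigma>\<close>.\<close>

definition reproducing_pair ::
    "('i \<Rightarrow> 'h::complex_hilbert) \<Rightarrow> ('i \<Rightarrow> 'h) \<Rightarrow> bool" where
  "reproducing_pair \<Psi> \<Phi> \<longleftrightarrow>
    (\<exists>\<sigma> :: nat \<Rightarrow> 'i. bij \<sigma> \<and>
      (\<exists>S :: 'h \<Rightarrow> 'h. bounded_clinear S \<and> boundedly_invertible S \<and>
        (\<forall>f g. (\<lambda>k. cinner f (\<Psi> (\<sigma> k)) * cinner (\<Phi> (\<sigma> k)) g) sums cinner (S f) g)))"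


section \<open>The Hilbert space of square-integrable functions on the unit interval\<close>

abbreviation torus :: "real measure" where
  "torus \<equiv> lebesgue_on {0..<1}"

definition square_int :: "(real \<Rightarrow> complex) \<Rightarrow> bool" where
  "square_int f \<longleftrightarrow> f \<in> borel_measurable torus \<and> integrable torus (\<lambda>t. (cmod (f t))\<^sup>2)"

lemma square_int_measurable [measurable_dest]: "square_int f \<Longrightarrow> f \<in> borel_measurable torus"
  by (simp add: square_int_def)

lemma borel_measurable_cnj [measurable]:
  "f \<in> borel_measurable M \<Longrightarrow> (\<lambda>t. cnj (f t)) \<in> borel_measurable M"
  by (erule measurable_compose) (intro borel_measurable_continuous_onI continuous_intros)

lemma square_int_mult_integrable:
  assumes "square_int f" "square_int g"
  shows "integrable torus (\<lambda>t. f t * cnj (g t))"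
proof (rule Bochner_Integration.integrable_bound)
  show "integrable torus (\<lambda>t. (cmod (f t))\<^sup>2 + (cmod (g t))\<^sup>2)"
    using assms by (simp add: square_int_def)
  show "(\<lambda>t. f t * cnj (g t)) \<in> borel_measurable torus"
    using assms[THEN square_int_measurable] by measurable
  have "cmod (f t * cnj (g t)) \<le> (cmod (f t))\<^sup>2 + (cmod (g t))\<^sup>2" for t
  proof -
    have "2 * (cmod (f t) * cmod (g t)) \<le> (cmod (f t))\<^sup>2 + (cmod (g t))\<^sup>2"
      using sum_squares_bound[of "cmod (f t)" "cmod (g t)"] by (simp add: mult.assoc)
    moreover have "0 \<le> cmod (f t) * cmod (g t)" by simp
    ultimately have "cmod (f t) * cmod (g t) \<le> (cmod (f t))\<^sup>2 + (cmod (g t))\<^sup>2" by linarith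
    then show ?thesis by (simp add: norm_mult)
  qed
  then show "AE t in torus. norm (f t * cnj (g t)) \<le> norm ((cmod (f t))\<^sup>2 + (cmod (g t))\<^sup>2)"
    by (intro AE_I2) (simp add: order_trans[OF _ abs_ge_self])
qed

lemma integral_mult_cnj_self:
  "(LINT t|M. f t * cnj (f t)) = complex_of_real (LINT t|M. (cmod (f t))\<^sup>2)"
proof -
  have "(\<lambda>t. f t * cnj (f t)) = (\<lambda>t. complex_of_real ((cmod (f t))\<^sup>2))"
    by (simp only: complex_norm_square)
  then show ?thesis by (simp only: integral_complex_of_real)
qed

lemma square_int_add:
  assumes "square_int f" "square_int g"
  shows "square_int (\<lambda>t. f t + g t)"
  unfolding square_int_def
proof
  show m: "(\<lambda>t. f t + g t) \<in> borel_measurable torus"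
    using assms[THEN square_int_measurable] by measurable
  have "(cmod (f t + g t))\<^sup>2 \<le> 2 * ((cmod (f t))\<^sup>2 + (cmod (g t))\<^sup>2)" for t
  proof -
    have "(cmod (f t + g t))\<^sup>2 \<le> (cmod (f t) + cmod (g t))\<^sup>2"
      by (intro power_mono norm_triangle_ineq) simp
    also have "\<dots> \<le> 2 * ((cmod (f t))\<^sup>2 + (cmod (g t))\<^sup>2)"
      using sum_squares_bound[of "cmod (f t)" "cmod (g t)"] by (simp add: power2_sum)
    finally show ?thesis .
  qed
  then have bound: "AE t in torus. norm ((cmod (f t + g t))\<^sup>2)
      \<le> norm (2 * ((cmod (f t))\<^sup>2 + (cmod (g t))\<^sup>2))"
    by (intro AE_I2) (simp add: order_trans[OF _ abs_ge_self])
  have int: "integrable torus (\<lambda>t. 2 * ((cmod (f t))\<^sup>2 + (cmod (g t))\<^sup>2))"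
    using assms by (simp add: square_int_def)
  have "(\<lambda>t. (cmod (f t + g t))\<^sup>2) \<in> borel_measurable torus"
    using m by measurable
  then show "integrable torus (\<lambda>t. (cmod (f t + g t))\<^sup>2)"
    by (rule Bochner_Integration.integrable_bound[OF int _ bound])
qed

lemma square_int_scale: "square_int f \<Longrightarrow> square_int (\<lambda>t. c * f t)"
  by (auto simp: square_int_def norm_mult power_mult_distrib)

lemma square_int_uminus: "square_int f \<Longrightarrow> square_int (\<lambda>t. - f t)"
  by (simp add: square_int_def)

lemma square_int_diff: "square_int f \<Longrightarrow> square_int g \<Longrightarrow> square_int (\<lambda>t. f t - g t)"
  using square_int_add[OF _ square_int_uminus] by fastforce

definition ae_eq :: "(real \<Rightarrow> complex) \<Rightarrow> (real \<Rightarrow> complex) \<Rightarrow> bool" where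
  "ae_eq f g \<longleftrightarrow> square_int f \<and> square_int g \<and> (AE t in torus. f t = g t)"

quotient_type L2 = "real \<Rightarrow> complex" / partial: ae_eq
  morphisms rep_L2 class_L2
proof (rule part_equivpI)
  have "ae_eq (\<lambda>_. 0) (\<lambda>_. 0)" by (simp add: ae_eq_def square_int_def)
  then show "\<exists>f. ae_eq f f" by blast
  show "symp ae_eq" by (rule sympI) (auto simp: ae_eq_def elim: AE_mp)
  show "transp ae_eq" by (rule transpI) (auto simp: ae_eq_def)
qed

lemma ae_eq_refl_iff: "ae_eq f f \<longleftrightarrow> square_int f"
  by (simp add: ae_eq_def)

lemma square_int_rep_L2: "square_int (rep_L2 x)"
  using Quotient_rep_reflp[OF Quotient_L2] by (simp add: ae_eq_refl_iff)

lemma class_rep_L2: "class_L2 (rep_L2 x) = x"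
  by (rule Quotient_abs_rep[OF Quotient_L2])

instantiation L2 :: complex_inner
begin

lift_definition zero_L2 :: L2 is "\<lambda>_. 0"
  by (simp add: ae_eq_def square_int_def)

lift_definition plus_L2 :: "L2 \<Rightarrow> L2 \<Rightarrow> L2" is "\<lambda>f g t. f t + g t"
  by (auto simp: ae_eq_def square_int_add)

lift_definition uminus_L2 :: "L2 \<Rightarrow> L2" is "\<lambda>f t. - f t"
  by (auto simp: ae_eq_def square_int_uminus)

lift_definition minus_L2 :: "L2 \<Rightarrow> L2 \<Rightarrow> L2" is "\<lambda>f g t. f t - g t"
  by (auto simp: ae_eq_def square_int_diff)

lift_definition scaleC_L2 :: "complex \<Rightarrow> L2 \<Rightarrow> L2" is "\<lambda>c f t. c * f t"
  by (auto simp: ae_eq_def square_int_scale)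

lift_definition cinner_L2 :: "L2 \<Rightarrow> L2 \<Rightarrow> complex" is "\<lambda>f g. LINT t|torus. f t * cnj (g t)"
proof -
  fix f f' g g' assume "ae_eq f f'" "ae_eq g g'"
  note * = this[unfolded ae_eq_def]
  then have [measurable]: "f \<in> borel_measurable torus" "f' \<in> borel_measurable torus"
    "g \<in> borel_measurable torus" "g' \<in> borel_measurable torus"
    by (auto dest: square_int_measurable)
  show "(LINT t|torus. f t * cnj (g t)) = (LINT t|torus. f' t * cnj (g' t))"
    using * by (intro integral_cong_AE) auto
qed

definition scaleR_L2 :: "real \<Rightarrow> L2 \<Rightarrow> L2" where
  "scaleR_L2 r x = complex_of_real r *\<^sub>C x"

definition inner_L2 :: "L2 \<Rightarrow> L2 \<Rightarrow> real" where
  "inner_L2 x y = Re (cinner x y)"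

definition norm_L2 :: "L2 \<Rightarrow> real" where
  "norm_L2 x = sqrt (inner x x)"

definition dist_L2 :: "L2 \<Rightarrow> L2 \<Rightarrow> real" where
  "dist_L2 x y = norm (x - y)"

definition sgn_L2 :: "L2 \<Rightarrow> L2" where
  "sgn_L2 x = inverse (norm x) *\<^sub>R x"

definition uniformity_L2 :: "(L2 \<times> L2) filter" where
  "uniformity_L2 = (INF e\<in>{0<..}. principal {(x, y). dist x y < e})"

definition open_L2 :: "L2 set \<Rightarrow> bool" where
  "open_L2 U \<longleftrightarrow> (\<forall>x\<in>U. \<forall>\<^sub>F (x', y) in uniformity. x' = x \<longrightarrow> y \<in> U)"

instance
proof
  fix x y z :: L2 and r s :: real and c d :: complex
  show "x + y + z = x + (y + z)"
    by transfer (simp add: ae_eq_def algebra_simps square_int_add)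
  show "x + y = y + x"
    by transfer (simp add: ae_eq_def algebra_simps square_int_add)
  show "0 + x = x"
    by transfer (auto simp: ae_eq_def)
  show "- x + x = 0"
    by transfer (auto simp: ae_eq_def square_int_def)
  show "x - y = x + - y"
    by transfer (auto simp: ae_eq_def square_int_diff)
  show addr: "c *\<^sub>C (x + y) = c *\<^sub>C x + c *\<^sub>C y" for c and x y :: L2
    by transfer (simp add: ae_eq_def algebra_simps square_int_add square_int_scale)
  show addl: "(c + d) *\<^sub>C x = c *\<^sub>C x + d *\<^sub>C x" for c d and x :: L2
    by transfer (simp add: ae_eq_def algebra_simps square_int_add square_int_scale)
  show scsc: "c *\<^sub>C (d *\<^sub>C x) = (c * d) *\<^sub>C x" for c d and x :: L2
    by transfer (auto simp: ae_eq_def mult.assoc intro!: square_int_scale)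
  show "complex_of_real r *\<^sub>C x = r *\<^sub>R x"
    by (simp add: scaleR_L2_def)
  show "r *\<^sub>R (x + y) = r *\<^sub>R x + r *\<^sub>R y"
    by (simp add: scaleR_L2_def addr)
  show "(r + s) *\<^sub>R x = r *\<^sub>R x + s *\<^sub>R x"
    by (simp add: scaleR_L2_def addl)
  show "r *\<^sub>R s *\<^sub>R x = (r * s) *\<^sub>R x"
    by (simp add: scaleR_L2_def scsc)
  show "1 *\<^sub>R x = x"
    unfolding scaleR_L2_def by transfer (auto simp: ae_eq_def)
  show comm: "cinner x y = cnj (cinner y x)" for x y :: L2
    by transfer (simp flip: Bochner_Integration.integral_cnj add: mult.commute)
  show cadd: "cinner (x + y) z = cinner x z + cinner y z" for x y z :: L2
    by transfer
      (simp add: ae_eq_def distrib_right square_int_mult_integrable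
        flip: Bochner_Integration.integral_add)
  show cscale: "cinner (c *\<^sub>C x) y = c * cinner x y" for c and x y :: L2
    by transfer (simp add: mult.assoc)
  show "Re (cinner x y) = inner x y"
    by (simp add: inner_L2_def)
  show "inner x y = inner y x"
    by (simp add: inner_L2_def comm [of x y])
  show "inner (x + y) z = inner x z + inner y z"
    by (simp add: inner_L2_def cadd)
  show "inner (r *\<^sub>R x) y = r * inner x y"
    by (simp add: inner_L2_def scaleR_L2_def cscale)
  show "0 \<le> inner x x"
    unfolding inner_L2_def by transfer (simp add: integral_mult_cnj_self)
  show "inner x x = 0 \<longleftrightarrow> x = 0"
    unfolding inner_L2_def
  proof transfer
    fix f assume "ae_eq f f"
    then have f: "square_int f" by (simp add: ae_eq_def)
    then have "(LINT t|torus. (cmod (f t))\<^sup>2) = 0 \<longleftrightarrow> (AE t in torus. (cmod (f t))\<^sup>2 = 0)"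
      by (intro integral_nonneg_eq_0_iff_AE) (auto simp: square_int_def)
    then show "Re (LINT t|torus. f t * cnj (f t)) = 0 \<longleftrightarrow> ae_eq f (\<lambda>_. 0)"
      using f by (auto simp: integral_mult_cnj_self ae_eq_def square_int_def)
  qed
  show "norm x = sqrt (inner x x)" by (rule norm_L2_def)
  show "dist x y = norm (x - y)" by (rule dist_L2_def)
  show "sgn x = inverse (norm x) *\<^sub>R x" by (rule sgn_L2_def)
  show "uniformity = (INF e\<in>{0<..}. principal {(x::L2, y). dist x y < e})"
    by (rule uniformity_L2_def)
  show "open U \<longleftrightarrow> (\<forall>x\<in>U. \<forall>\<^sub>F (x', y) in uniformity. x' = x \<longrightarrow> y \<in> U)" for U :: "L2 set"
    by (rule open_L2_def)
qed

end

lemma norm_class_L2: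
  assumes "square_int f"
  shows "(norm (class_L2 f))\<^sup>2 = (LINT t|torus. (cmod (f t))\<^sup>2)"
proof -
  have "cinner (class_L2 f) (class_L2 f) = (LINT t|torus. f t * cnj (f t))"
    using assms by (simp add: cinner_L2.abs_eq ae_eq_refl_iff)
  then show ?thesis
    by (simp add: power2_norm_eq_inner inner_L2_def integral_mult_cnj_self)
qed

lemma dist_L2_rep:
  "(dist x y)\<^sup>2 = (LINT t|torus. (cmod (rep_L2 x t - rep_L2 y t))\<^sup>2)"
proof -
  have "x - y = class_L2 (\<lambda>t. rep_L2 x t - rep_L2 y t)"
    using minus_L2.abs_eq[of "rep_L2 x" "rep_L2 y"]
    by (simp add: ae_eq_refl_iff square_int_rep_L2 class_rep_L2)
  then show ?thesis
    by (simp add: dist_norm norm_class_L2 square_int_diff square_int_rep_L2)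
qed

instance L2 :: complex_hilbert
proof
  fix X :: "nat \<Rightarrow> L2" assume X: "Cauchy X"
  define s where "s n = rep_L2 (X n)" for n
  have s: "square_int (s n)" for n by (simp add: s_def square_int_rep_L2)
  note [measurable] = square_int_measurable[OF s]
  have d: "square_int (\<lambda>t. s m t - s n t)" for m n by (intro square_int_diff s)
  have dist: "(dist (X m) (X n))\<^sup>2 = (LINT t|torus. (cmod (s m t - s n t))\<^sup>2)" for m n
    by (simp add: dist_L2_rep s_def)
  have "{0..<1::real} \<in> lmeasurable"
    by (intro bounded_set_imp_lmeasurable bounded_subset[OF bounded_closed_interval[of 0 1]]) auto
  then have prob: "measure torus (space torus) = 1" "finite_measure torus"
    by (auto simp: measure_restrict_space intro!: finite_measure_lebesgue_on)
  interpret finite_measure torus by (rule prob)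
  have int1: "integrable torus f" if "square_int f" for f
  proof -
    note [measurable] = square_int_measurable[OF that]
    have "integrable torus (\<lambda>t. cmod (f t))"
      by (rule square_integrable_imp_integrable) (use that in \<open>simp_all add: square_int_def\<close>)
    then show ?thesis by (subst (asm) integrable_norm_iff) measurable
  qed
  have "\<exists>N. \<forall>i\<ge>N. \<forall>j\<ge>N. LINT t|torus. cmod (s i t - s j t) < e" if "e > 0" for e
  proof -
    obtain N where N: "\<And>i j. i \<ge> N \<Longrightarrow> j \<ge> N \<Longrightarrow> dist (X i) (X j) < e"
      using X \<open>e > 0\<close> unfolding Cauchy_def by blast
    have "(LINT t|torus. cmod (s i t - s j t)) < e" if ij: "i \<ge> N" "j \<ge> N" for i j
    proof -
      let ?u = "\<lambda>t. cmod (s i t - s j t)"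
      have "?u t \<le> e / 2 + (?u t)\<^sup>2 / (2 * e)" for t
        using sum_squares_bound[of e "?u t"] \<open>e > 0\<close>
        by (simp add: field_simps power2_eq_square)
      then have "(LINT t|torus. ?u t) \<le> (LINT t|torus. e / 2 + (?u t)\<^sup>2 / (2 * e))"
        using int1[OF d] d by (intro integral_mono) (auto simp: square_int_def)
      also have "\<dots> = e / 2 + (dist (X i) (X j))\<^sup>2 / (2 * e)"
        using d prob by (subst Bochner_Integration.integral_add) (auto simp: square_int_def dist)
      also have "\<dots> < e / 2 + e\<^sup>2 / (2 * e)"
        using N[OF ij] \<open>e > 0\<close> by (intro add_strict_left_mono divide_strict_right_mono power_strict_mono) auto
      also have "\<dots> = e" using \<open>e > 0\<close> by (simp add: power2_eq_square)
      finally show ?thesis .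
    qed
    then show ?thesis by blast
  qed
  then obtain r where r: "strict_mono r" "AE t in torus. Cauchy (\<lambda>i. s (r i) t)"
    using cauchy_L1_AE_cauchy_subseq[of torus s] int1[OF s] by blast
  define f where "f t = lim (\<lambda>i. s (r i) t)" for t
  have fm [measurable]: "f \<in> borel_measurable torus"
    unfolding f_def by (rule borel_measurable_lim_metric) simp
  have lim: "AE t in torus. (\<lambda>i. s (r i) t) \<longlonglongrightarrow> f t"
    using r(2) by eventually_elim (simp add: f_def Cauchy_convergent_iff convergent_LIMSEQ_iff)
  have fatou: "square_int (\<lambda>t. f t - s n t) \<and> (LINT t|torus. (cmod (f t - s n t))\<^sup>2) \<le> e\<^sup>2"
    if N: "\<And>i. i \<ge> N \<Longrightarrow> dist (X i) (X n) < e" and "e > 0" for N n e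
  proof -
    have "(\<integral>\<^sup>+t. ennreal ((cmod (f t - s n t))\<^sup>2) \<partial>torus)
        = (\<integral>\<^sup>+t. liminf (\<lambda>i. ennreal ((cmod (s (r i) t - s n t))\<^sup>2)) \<partial>torus)"
    proof (rule nn_integral_cong_AE)
      show "AE t in torus. ennreal ((cmod (f t - s n t))\<^sup>2)
          = liminf (\<lambda>i. ennreal ((cmod (s (r i) t - s n t))\<^sup>2))"
        using lim
      proof eventually_elim
        case (elim t)
        have "(\<lambda>i. ennreal ((cmod (s (r i) t - s n t))\<^sup>2)) \<longlonglongrightarrow> ennreal ((cmod (f t - s n t))\<^sup>2)"
          using elim by (intro tendsto_intros)
        then show ?case using lim_imp_Liminf by (metis sequentially_bot)
      qed
    qed
    also have "\<dots> \<le> liminf (\<lambda>i. \<integral>\<^sup>+t. ennreal ((cmod (s (r i) t - s n t))\<^sup>2) \<partial>torus)"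
      by (rule nn_integral_liminf) measurable
    also have "\<dots> \<le> ennreal (e\<^sup>2)"
    proof -
      have "(\<integral>\<^sup>+t. ennreal ((cmod (s (r i) t - s n t))\<^sup>2) \<partial>torus) \<le> ennreal (e\<^sup>2)" if "i \<ge> N" for i
      proof -
        have "r i \<ge> N" using that seq_suble[OF r(1), of i] by linarith
        then have "(dist (X (r i)) (X n))\<^sup>2 \<le> e\<^sup>2"
          using less_imp_le[OF N] by (intro power_mono) simp_all
        moreover have "(\<integral>\<^sup>+t. ennreal ((cmod (s (r i) t - s n t))\<^sup>2) \<partial>torus)
            = ennreal ((dist (X (r i)) (X n))\<^sup>2)"
          unfolding dist using d by (intro nn_integral_eq_integral) (auto simp: square_int_def)
        ultimately show ?thesis by (simp add: ennreal_leI)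
      qed
      then have "\<forall>\<^sub>F i in sequentially.
          (\<integral>\<^sup>+t. ennreal ((cmod (s (r i) t - s n t))\<^sup>2) \<partial>torus) \<le> ennreal (e\<^sup>2)"
        by (auto simp: eventually_sequentially)
      then have "liminf (\<lambda>i. \<integral>\<^sup>+t. ennreal ((cmod (s (r i) t - s n t))\<^sup>2) \<partial>torus)
          \<le> liminf (\<lambda>i. ennreal (e\<^sup>2))"
        by (rule Liminf_mono)
      then show ?thesis by (simp add: Liminf_const)
    qed
    finally have le: "(\<integral>\<^sup>+t. ennreal ((cmod (f t - s n t))\<^sup>2) \<partial>torus) \<le> ennreal (e\<^sup>2)" .
    then have i: "integrable torus (\<lambda>t. (cmod (f t - s n t))\<^sup>2)"
      by (intro integrableI_bounded) (auto simp: le_less_trans[OF _ ennreal_less_top])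
    then show ?thesis
      using le by (auto simp: square_int_def nn_integral_eq_integral)
  qed
  have f: "square_int f"
  proof -
    obtain N where "\<And>i j. i \<ge> N \<Longrightarrow> j \<ge> N \<Longrightarrow> dist (X i) (X j) < 1"
      using X unfolding Cauchy_def by (meson zero_less_one)
    then have "square_int (\<lambda>t. f t - s N t)" using fatou[of N N 1] by auto
    from square_int_add[OF this s[of N]] show ?thesis by simp
  qed
  have "X \<longlonglongrightarrow> class_L2 f"
  proof (rule metric_LIMSEQ_I)
    fix e :: real assume "e > 0"
    then obtain N where N: "\<And>i j. i \<ge> N \<Longrightarrow> j \<ge> N \<Longrightarrow> dist (X i) (X j) < e / 2"
      using X unfolding Cauchy_def by (meson half_gt_zero)
    have "dist (X n) (class_L2 f) < e" if "n \<ge> N" for n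
    proof -
      have "class_L2 f - X n = class_L2 (\<lambda>t. f t - s n t)"
        using minus_L2.abs_eq[of f "s n"] f s by (simp add: ae_eq_refl_iff) (simp add: s_def class_rep_L2)
      then have "(dist (X n) (class_L2 f))\<^sup>2 = (LINT t|torus. (cmod (f t - s n t))\<^sup>2)"
        by (subst dist_commute) (simp add: dist_norm norm_class_L2 square_int_diff f s)
      also have "\<dots> \<le> (e / 2)\<^sup>2"
        using fatou[of N n "e / 2"] N that \<open>e > 0\<close> by auto
      finally have "dist (X n) (class_L2 f) \<le> e / 2"
        by (rule power2_le_imp_le) (use \<open>e > 0\<close> in simp)
      then show ?thesis using \<open>e > 0\<close> by linarith
    qed
    then show "\<exists>N. \<forall>n\<ge>N. dist (X n) (class_L2 f) < e" by blast
  qed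
  then show "convergent X" by (auto simp: convergent_def)
qed


section \<open>Weighted exponentials and quotients\<close>

definition expo :: "int \<Rightarrow> real \<Rightarrow> complex" where
  "expo n t = exp (2 * of_real pi * \<i> * of_int n * of_real t)"

text \<open>The system \<open>E(g, \<int>)\<close>, as elements of \<^typ>\<open>L2\<close>; it is meant for \<open>square_int g\<close>, since
  \<^const>\<open>class_L2\<close> is unspecified on functions that are not square-integrable.\<close>

definition weighted_exponentials :: "(real \<Rightarrow> complex) \<Rightarrow> int \<Rightarrow> L2" where
  "weighted_exponentials g n = class_L2 (\<lambda>t. g t * expo n t)"

lemma square_int_weighted_exponential:
  assumes "square_int g"
  shows "square_int (\<lambda>t. g t * expo n t)"
proof -
  have "cmod (expo n t) = 1" for t
    by (simp add: expo_def norm_exp_eq_Re)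
  moreover have "continuous_on {0..<1} (expo n)"
    unfolding expo_def by (intro continuous_intros)
  then have "expo n \<in> borel_measurable torus"
    by (rule continuous_imp_measurable_on_sets_lebesgue) simp
  ultimately show ?thesis
    using assms by (auto simp: square_int_def norm_mult)
qed

text \<open>\<open>h / g\<close> is a square-integrable function. As \<open>x / 0 = 0\<close> in HOL, it has to be required
  separately that the quotient is defined almost everywhere; otherwise \<open>1 / g\<close> would count as
  square-integrable for \<open>g = 0\<close>.\<close>

definition quotient_square_int :: "(real \<Rightarrow> complex) \<Rightarrow> (real \<Rightarrow> complex) \<Rightarrow> bool" where
  "quotient_square_int h g \<longleftrightarrow> (AE t in torus. g t \<noteq> 0) \<and> square_int (\<lambda>t. h t / g t)"

end

theory Submission
  imports Defs
begin

text \<open>If \<open>(\<Psi>, E(g, \<int>))\<close> is a reproducing pair, two applications of the uniform boundedness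
  principle show that \<open>\<Psi>\<close> is bounded, because \<open>\<parallel>g e\<^sub>n\<parallel>\<close> does not depend on \<open>n\<close>. The functions
  \<open>e\<^sub>k / cnj g\<close> that would be dual to \<open>g e\<^sub>k\<close> are not square-integrable, but with
  \<open>z(t) = exp (- 2 \<pi> i (t - t\<^sub>0))\<close> the functions \<open>w\<^sub>k = cnj ((z ^ k - 1) / g)\<close> are, since the
  zero of \<open>z ^ k - 1\<close> at \<open>t\<^sub>0\<close> compensates for \<open>1 / g\<close>. As \<open>\<langle>g e\<^sub>n, w\<^sub>k\<rangle>\<close> vanishes except at
  \<open>n = k\<close> and \<open>n = 0\<close>, expanding \<open>\<langle>S f, w\<^sub>k\<rangle>\<close> bounds \<open>\<parallel>w\<^sub>k\<parallel>\<close> uniformly in \<open>k\<close>. Averaging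
  \<open>|z ^ k - 1|\<^sup>2 / |g|\<^sup>2\<close> over \<open>k\<close> and using Fatou's lemma yields \<open>1 / g \<in> L\<^sup>2\<close>.\<close>

section \<open>Uniform boundedness\<close>

text \<open>The Banach-Steinhaus theorem for the functionals \<open>inner _ (x n)\<close>: by Baire,
  one of the closed sets \<open>F m\<close> contains a ball, and a pointwise bound on a ball bounds
  the norms of all \<open>x n\<close>.\<close>

lemma uniform_boundedness_inner:
  fixes x :: "'i \<Rightarrow> 'h::{real_inner, complete_space}"
  assumes "\<And>f. bounded (range (\<lambda>n. inner f (x n)))"
  shows "bounded (range x)"
proof -
  define F where "F m = {f::'h. \<forall>n. \<bar>inner f (x n)\<bar> \<le> real m}" for m :: nat
  have F_closed: "closed (F m)" for m
    unfolding F_def by (intro closed_Collect_all closed_Collect_le continuous_intros)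
  have "\<exists>m. f \<in> F m" for f
  proof -
    obtain B where B: "\<And>n. \<bar>inner f (x n)\<bar> \<le> B"
      using assms[of f] by (auto simp: bounded_iff)
    moreover obtain m where "B \<le> real m" using real_arch_simple by blast
    ultimately have "f \<in> F m" unfolding F_def by (blast intro: order_trans)
    then show ?thesis ..
  qed
  then have cover: "\<Union>(range F) = UNIV" by auto
  have "\<exists>m. interior (F m) \<noteq> {}"
  proof (rule ccontr)
    assume "\<nexists>m. interior (F m) \<noteq> {}"
    then have "euclidean interior_of \<Union>(range F) = {}"
      using F_closed completely_metrizable_space_euclidean
      by (intro Baire_category_alt) auto
    then show False by (simp add: cover)
  qed
  then obtain m f e where e: "e > 0" "cball f e \<subseteq> F m"
    by (metis all_not_in_conv mem_interior_cball)
  have "norm (x n) \<le> 2 * real m / e" for n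
  proof (cases "x n = 0")
    case False
    \<comment> \<open>Rescaled to length \<open>e\<close>, \<open>x n\<close> leads from the centre
      \<open>f\<close> to another point of the ball. Subtracting the bounds at \<open>f\<close> and
      \<open>f + u\<close> produces the factor 2.\<close>
    define u where "u = (e / norm (x n)) *\<^sub>R x n"
    have "f \<in> F m" "f + u \<in> F m"
      using e False by (auto simp: u_def dist_norm intro!: subsetD[OF e(2)])
    then have "\<bar>inner f (x n)\<bar> \<le> real m" "\<bar>inner (f + u) (x n)\<bar> \<le> real m"
      by (auto simp: F_def)
    then have "inner u (x n) \<le> 2 * real m"
      by (simp add: inner_add_left)
    moreover have "inner u (x n) = e * norm (x n)"
      using False by (simp add: u_def power2_norm_eq_inner[symmetric] power2_eq_square)
    ultimately show ?thesis using e by (simp add: field_simps)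
  qed (use e in simp)
  then show ?thesis by (auto simp: bounded_iff)
qed

section \<open>Reproducing pairs in a complex Hilbert space\<close>

lemma abs_inner_le_cmod_cinner: "\<bar>inner x y\<bar> \<le> cmod (cinner x y)"
  using abs_Re_le_cmod[of "cinner x y"] by (simp add: Re_cinner)

lemma norm_scaleC: "norm (c *\<^sub>C x) = cmod c * norm (x :: 'h::complex_inner)"
proof -
  have self: "cinner y y = complex_of_real ((norm y)\<^sup>2)" for y :: 'h
    using cinner_commute[of y y] Re_cinner[of y y]
    by (simp add: complex_eq_iff power2_norm_eq_inner)
  have "cinner (c *\<^sub>C x) (c *\<^sub>C x) = c * cnj c * cinner x x"
    by (metis cinner_scaleC_left cinner_commute complex_cnj_mult mult.assoc)
  then have "complex_of_real ((norm (c *\<^sub>C x))\<^sup>2) = complex_of_real ((cmod c * norm x)\<^sup>2)"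
    unfolding self complex_norm_square[symmetric] by (simp add: power_mult_distrib)
  then have "(norm (c *\<^sub>C x))\<^sup>2 = (cmod c * norm x)\<^sup>2"
    using of_real_eq_iff by blast
  then show ?thesis by (simp add: power2_eq_iff_nonneg)
qed

text \<open>The terms of a convergent series are bounded, so for fixed \<open>f\<close> the vectors
  \<open>?x n\<close> are weakly bounded and hence bounded in norm. Dividing by the lower bound
  \<open>c\<close> leaves a bound on \<open>cinner f (\<Psi> n)\<close> for each \<open>f\<close>,
  and uniform boundedness applies again, now to \<Psi>.\<close>

lemma reproducing_pair_bounded:
  fixes \<Psi> \<Phi> :: "'i \<Rightarrow> 'h::complex_hilbert"
  assumes "reproducing_pair \<Psi> \<Phi>" and "c > 0" and c: "\<And>n. c \<le> norm (\<Phi> n)"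
  shows "bounded (range \<Psi>)"
proof (rule uniform_boundedness_inner)
  fix f :: 'h
  obtain \<sigma> :: "nat \<Rightarrow> 'i" and S :: "'h \<Rightarrow> 'h" where "bij \<sigma>"
    and sums: "\<And>f g. (\<lambda>k. cinner f (\<Psi> (\<sigma> k)) * cinner (\<Phi> (\<sigma> k)) g) sums cinner (S f) g"
    using assms(1) unfolding reproducing_pair_def by blast
  let ?x = "\<lambda>n. cinner f (\<Psi> n) *\<^sub>C \<Phi> n"
  have "bounded (range ?x)"
  proof (rule uniform_boundedness_inner)
    fix g
    have "Bseq (\<lambda>k. cinner f (\<Psi> (\<sigma> k)) * cinner (\<Phi> (\<sigma> k)) g)"
      using summable_LIMSEQ_zero[OF sums_summable[OF sums]] convergent_imp_Bseq convergentI by blast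
    then obtain B where B: "\<And>k. cmod (cinner f (\<Psi> (\<sigma> k)) * cinner (\<Phi> (\<sigma> k)) g) \<le> B"
      by (auto simp: Bseq_def)
    have "\<bar>inner g (?x n)\<bar> \<le> B" for n
    proof -
      obtain k where "n = \<sigma> k" using \<open>bij \<sigma>\<close> by (metis bij_pointE)
      then show ?thesis
        using B[of k] abs_inner_le_cmod_cinner[of "?x n" g]
        by (simp add: inner_commute cinner_scaleC_left)
    qed
    then show "bounded (range (\<lambda>n. inner g (?x n)))" by (auto simp: bounded_iff)
  qed
  then obtain B where B: "\<And>n. norm (?x n) \<le> B" by (auto simp: bounded_iff)
  have "\<bar>inner f (\<Psi> n)\<bar> \<le> B / c" for n
  proof -
    have "cmod (cinner f (\<Psi> n)) * c \<le> norm (?x n)"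
      using c[of n] by (simp add: norm_scaleC mult_left_mono)
    then have "cmod (cinner f (\<Psi> n)) * c \<le> B" using B[of n] by simp
    then show ?thesis
      using abs_inner_le_cmod_cinner[of f "\<Psi> n"] \<open>c > 0\<close>
      by (simp add: pos_le_divide_eq) (smt (verit) mult_right_mono)
  qed
  then show "bounded (range (\<lambda>n. inner f (\<Psi> n)))" by (auto simp: bounded_iff)
qed

text \<open>Rotating \<open>x\<close> by a unimodular scalar makes the inner product real and
  nonnegative, which reduces the claim to the real Cauchy-Schwarz inequality.\<close>

lemma cmod_cinner_le: "cmod (cinner x y) \<le> norm x * norm (y :: 'h::complex_inner)"
proof (cases "cinner x y = 0")
  case False
  define c where "c = cnj (sgn (cinner x y))"
  have "cmod c = 1" using False by (simp add: c_def norm_sgn)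
  have "cinner (c *\<^sub>C x) y = complex_of_real (cmod (cinner x y))"
    using False by (simp add: cinner_scaleC_left c_def sgn_eq mult.commute[of "cnj _"]
        complex_norm_square[symmetric] power2_eq_square)
  then have "cmod (cinner x y) = inner (c *\<^sub>C x) y"
    by (metis Re_cinner Re_complex_of_real)
  also have "\<dots> \<le> norm (c *\<^sub>C x) * norm y" by (rule norm_cauchy_schwarz)
  finally show ?thesis by (simp add: norm_scaleC \<open>cmod c = 1\<close>)
qed simp

text \<open>The vectors \<open>w\<close> play the role of differences \<open>cnj \<alpha> *\<^sub>C \<phi>'\<^sub>k - \<phi>'\<^sub>m\<close> of a biorthogonal family
  \<open>\<phi>'\<close>, whose members need not exist.\<close>

lemma reproducing_pair_difference_bound:
  fixes \<Psi> \<Phi> :: "'i \<Rightarrow> 'h::complex_hilbert"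
  assumes "reproducing_pair \<Psi> \<Phi>" and "c > 0" and c: "\<And>n. c \<le> norm (\<Phi> n)"
  shows "\<exists>C. \<forall>\<alpha> k m w. cmod \<alpha> = 1 \<longrightarrow>
    (\<forall>n. cinner (\<Phi> n) w = (if n = k then \<alpha> else 0) - (if n = m then 1 else 0)) \<longrightarrow> norm w \<le> C"
proof -
  obtain M where M: "\<And>n. norm (\<Psi> n) \<le> M"
    using reproducing_pair_bounded[OF assms] by (auto simp: bounded_iff)
  obtain \<sigma> :: "nat \<Rightarrow> 'i" and S :: "'h \<Rightarrow> 'h" where "bij \<sigma>" and "boundedly_invertible S"
    and sums: "\<And>f g. (\<lambda>k. cinner f (\<Psi> (\<sigma> k)) * cinner (\<Phi> (\<sigma> k)) g) sums cinner (S f) g"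
    using assms(1) unfolding reproducing_pair_def by blast
  then obtain R where "bounded_linear R" "S \<circ> R = id"
    unfolding boundedly_invertible_def bounded_clinear_def by blast
  then obtain K where K: "\<And>h. norm (R h) \<le> norm h * K" and "K > 0"
    using bounded_linear.pos_bounded by blast
  have SR: "S (R h) = h" for h using \<open>S \<circ> R = id\<close> by (metis comp_apply id_apply)
  have "norm w \<le> 2 * K * M"
    if \<alpha>: "cmod \<alpha> = 1"
      and w: "\<And>n. cinner (\<Phi> n) w = (if n = k then \<alpha> else 0) - (if n = m then 1 else 0)"
    for \<alpha> k m w
  proof -
    \<comment> \<open>With this choice \<open>S f = w\<close>, so the series for
      \<open>cinner (S f) w\<close> sums to \<open>cinner w w\<close>.\<close>
    define f where "f = R w"
    \<comment> \<open>The only term that can be nonzero sits at position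
      \<open>inv \<sigma> i\<close>. Treating the indices \<open>k\<close> and \<open>m\<close> as
      two separate series also covers \<open>k = m\<close>.\<close>
    have single: "(\<lambda>j. cinner f (\<Psi> (\<sigma> j)) * (if \<sigma> j = i then \<beta> else 0)) sums (cinner f (\<Psi> i) * \<beta>)" for i \<beta>
    proof -
      have eq: "\<sigma> j = i \<longleftrightarrow> j = inv \<sigma> i" for j
        using \<open>bij \<sigma>\<close> by (metis bij_inv_eq_iff)
      show ?thesis
        using sums_single[of "inv \<sigma> i" "\<lambda>j. cinner f (\<Psi> (\<sigma> j)) * \<beta>"] \<open>bij \<sigma>\<close>
        by (simp add: eq if_distrib[of "(*) _"] bij_is_surj surj_f_inv_f cong: if_cong)
    qed
    have "(\<lambda>j. cinner f (\<Psi> (\<sigma> j)) * cinner (\<Phi> (\<sigma> j)) w)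
        sums (cinner f (\<Psi> k) * \<alpha> - cinner f (\<Psi> m) * 1)"
      unfolding w right_diff_distrib by (intro sums_diff single)
    then have "cinner w w = cinner f (\<Psi> k) * \<alpha> - cinner f (\<Psi> m)"
      using sums[of f w] sums_unique2 by (fastforce simp: f_def SR)
    then have "cmod (cinner w w) \<le> cmod (cinner f (\<Psi> k)) + cmod (cinner f (\<Psi> m))"
      using norm_triangle_ineq4[of "cinner f (\<Psi> k) * \<alpha>" "cinner f (\<Psi> m)"] \<alpha>
      by (simp add: norm_mult)
    also have "\<dots> \<le> norm f * M + norm f * M"
      using M by (intro add_mono order_trans[OF cmod_cinner_le] mult_left_mono) auto
    also have "\<dots> \<le> 2 * (norm w * K * M)"
      using mult_right_mono[OF K[of w] order_trans[OF norm_ge_zero M]]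
      by (simp add: f_def mult.commute)
    \<comment> \<open>The left side is quadratic in \<open>norm w\<close> and the right side only
      linear, so one factor cancels.\<close>
    finally have "(norm w)\<^sup>2 \<le> norm w * (2 * K * M)"
      using abs_inner_le_cmod_cinner[of w w] by (simp add: power2_norm_eq_inner mult_ac)
    moreover have "0 \<le> 2 * K * M"
      using order_trans[OF norm_ge_zero M] \<open>K > 0\<close> by simp
    ultimately show ?thesis
      by (cases "w = 0") (auto simp: power2_eq_square)
  qed
  then show ?thesis by blast
qed

section \<open>Cesaro averages on the unit circle\<close>

text \<open>Each summand equals \<open>2 - 2 * Re (z ^ k)\<close>, and the geometric sum of the
  powers stays bounded because \<open>z\<close> is not 1; hence the sum grows like
  \<open>2 * N\<close>.\<close>

lemma eventually_sum_power_minus_one_ge: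
  fixes z :: complex
  assumes "cmod z = 1" "z \<noteq> 1"
  shows "\<forall>\<^sub>F N in sequentially. real N \<le> (\<Sum>k<N. (cmod (z ^ k - 1))\<^sup>2)"
proof -
  \<comment> \<open>The geometric sum is at most \<open>2 / cmod (z - 1)\<close> and enters with
    factor 2, so from this threshold on it costs at most \<open>N\<close> of the total
    \<open>2 * N\<close>.\<close>
  have "real N \<le> (\<Sum>k<N. (cmod (z ^ k - 1))\<^sup>2)" if N: "4 / cmod (z - 1) \<le> real N" for N
  proof -
    have "(cmod (z ^ k - 1))\<^sup>2 = 2 - 2 * Re (z ^ k)" for k
    proof -
      have "(Re (z ^ k))\<^sup>2 + (Im (z ^ k))\<^sup>2 = 1"
        using assms(1) by (simp flip: cmod_power2 add: norm_power)
      then show ?thesis by (simp add: cmod_power2 power2_diff)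
    qed
    then have "(\<Sum>k<N. (cmod (z ^ k - 1))\<^sup>2) = 2 * real N - 2 * Re (\<Sum>k<N. z ^ k)"
      by (simp add: sum_subtractf sum_distrib_left)
    moreover have "Re (\<Sum>k<N. z ^ k) \<le> cmod (z ^ N - 1) / cmod (z - 1)"
      using complex_Re_le_cmod[of "\<Sum>k<N. z ^ k"] assms(2)
      by (simp add: geometric_sum norm_divide)
    moreover have "cmod (z ^ N - 1) / cmod (z - 1) \<le> 2 / cmod (z - 1)"
      using norm_triangle_ineq4[of "z ^ N" 1] assms(1)
      by (intro divide_right_mono) (simp_all add: norm_power)
    ultimately show ?thesis using N by simp
  qed
  then show ?thesis
    using eventually_ge_at_top[of "nat \<lceil>4 / cmod (z - 1)\<rceil>"]
    by (auto simp: nat_ceiling_le_eq elim: eventually_mono)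
qed

text \<open>The average of \<open>|z ^ k - 1|\<^sup>2\<close> over \<open>k < N\<close> is eventually at least \<open>1\<close>, so Fatou's lemma
  applied to the averaged hypotheses bounds the integral of \<open>|v|\<^sup>2\<close>.\<close>

lemma integrable_if_rotation_differences_bounded:
  fixes z v :: "'a \<Rightarrow> complex"
  assumes [measurable]: "z \<in> borel_measurable M" "v \<in> borel_measurable M"
    and z: "AE t in M. cmod (z t) = 1 \<and> z t \<noteq> 1"
    and int: "\<And>k. integrable M (\<lambda>t. (cmod ((z t ^ k - 1) * v t))\<^sup>2)"
    and le: "\<And>k. (LINT t|M. (cmod ((z t ^ k - 1) * v t))\<^sup>2) \<le> C"
  shows "integrable M (\<lambda>t. (cmod (v t))\<^sup>2)"
proof -
  define F where "F N t = (\<Sum>k<N. (cmod ((z t ^ k - 1) * v t))\<^sup>2) / real N" for N t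
  have F_int: "integrable M (F N)" for N
    unfolding F_def using int by auto
  have "C \<ge> 0" using order_trans[OF _ le[of 0]] by simp
  have "(LINT t|M. F N t) \<le> C" for N
  proof -
    have "(LINT t|M. F N t) = (\<Sum>k<N. LINT t|M. (cmod ((z t ^ k - 1) * v t))\<^sup>2) / real N"
      unfolding F_def using int by (simp add: Bochner_Integration.integral_sum)
    also have "\<dots> \<le> (\<Sum>k<N. C) / real N"
      by (intro divide_right_mono sum_mono le) simp
    \<comment> \<open>For \<open>N = 0\<close> the quotient is 0 by convention, and the sign of
      \<open>C\<close> settles this case.\<close>
    also have "\<dots> \<le> C" using \<open>C \<ge> 0\<close> by simp
    finally show ?thesis .
  qed
  then have nn: "(\<integral>\<^sup>+t. ennreal (F N t) \<partial>M) \<le> ennreal C" for N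
    using F_int by (subst nn_integral_eq_integral) (auto simp: F_def[of N] sum_nonneg ennreal_leI)
  have "(\<integral>\<^sup>+t. ennreal ((cmod (v t))\<^sup>2) \<partial>M) \<le> (\<integral>\<^sup>+t. liminf (\<lambda>N. ennreal (F N t)) \<partial>M)"
  proof (rule nn_integral_mono_AE)
    show "AE t in M. ennreal ((cmod (v t))\<^sup>2) \<le> liminf (\<lambda>N. ennreal (F N t))"
      using z
    proof eventually_elim
      case (elim t)
      have "\<forall>\<^sub>F N in sequentially. ennreal ((cmod (v t))\<^sup>2) \<le> ennreal (F N t)"
        using eventually_sum_power_minus_one_ge[OF conjunct1[OF elim] conjunct2[OF elim]]
          eventually_gt_at_top[of 0]
      proof eventually_elim
        case (elim N)
        have "F N t = (\<Sum>k<N. (cmod (z t ^ k - 1))\<^sup>2) / real N * (cmod (v t))\<^sup>2"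
          by (simp add: F_def norm_mult power_mult_distrib sum_distrib_right)
        also have "\<dots> \<ge> 1 * (cmod (v t))\<^sup>2"
          using elim by (intro mult_right_mono) simp_all
        finally show ?case by (simp add: ennreal_leI)
      qed
      then show ?case by (rule Liminf_bounded)
    qed
  qed
  also have "\<dots> \<le> liminf (\<lambda>N. \<integral>\<^sup>+t. ennreal (F N t) \<partial>M)"
    by (rule nn_integral_liminf) (simp add: F_def)
  also have "\<dots> \<le> liminf (\<lambda>N. ennreal C)"
    by (intro Liminf_mono always_eventually allI nn)
  also have "\<dots> = ennreal C" by (simp add: Liminf_const)
  finally show ?thesis
    by (intro integrableI_bounded) (auto simp: le_less_trans[OF _ ennreal_less_top])
qed


section \<open>Weighted exponentials\<close>

lemma expo_eq_exp_i: "expo n t = exp (\<i> * of_real (2 * pi * of_int n * t))"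
  by (simp add: expo_def mult_ac)

lemma cmod_expo: "cmod (expo n t) = 1"
  by (simp only: expo_eq_exp_i norm_exp_i_times)

lemma expo_add: "expo (m + n) t = expo m t * expo n t"
  by (simp add: expo_def flip: exp_add) (simp add: algebra_simps)

lemma expo_diff_right: "expo n (s - t) = expo n s * expo (- n) t"
  by (simp add: expo_def flip: exp_add) (simp add: algebra_simps)

lemma expo_power: "expo n t ^ k = expo (n * int k) t"
  by (simp add: expo_def flip: exp_of_nat_mult) (simp add: mult_ac)

lemma expo_minus_one_eq_1_iff: "expo (- 1) t = 1 \<longleftrightarrow> t \<in> \<int>"
proof -
  have "expo (- 1) t = 1 \<longleftrightarrow> (\<exists>n::int. - (2 * pi * t) = real_of_int (2 * n) * pi)"
    by (simp add: expo_eq_exp_i exp_eq_1)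
  also have "\<dots> \<longleftrightarrow> (\<exists>n::int. t = - real_of_int n)"
  proof -
    have "- (2 * pi * t) = real_of_int (2 * n) * pi \<longleftrightarrow> t = - real_of_int n" for n
    proof -
      have "- (2 * pi * t) = real_of_int (2 * n) * pi \<longleftrightarrow> (2 * pi) * t = (2 * pi) * - real_of_int n"
        by auto
      then show ?thesis by (simp only: mult_cancel_left) simp
    qed
    then show ?thesis by simp
  qed
  also have "\<dots> \<longleftrightarrow> t \<in> \<int>"
    by (subst minus_in_Ints_iff[of t, symmetric], unfold Ints_def image_iff)
      (simp add: eq_commute[of t] minus_equation_iff[of _ t] eq_commute[of "- t"])
  finally show ?thesis .
qed

text \<open>A chord of the unit circle is no longer than its arc. Applied at
  \<open>t - t\<^sub>0\<close>, this gives the linear decay that compensates for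
  \<open>1 / g\<close>.\<close>

lemma cmod_expo_minus_1_le: "cmod (expo n t - 1) \<le> 2 * pi * \<bar>of_int n * t\<bar>"
  using abs_sin_x_le_abs_x[of "pi * of_int n * t"]
  by (simp only: expo_eq_exp_i dist_exp_i_1) (simp add: abs_mult mult.assoc)

lemma continuous_on_expo: "continuous_on S (expo n)"
  unfolding expo_def by (intro continuous_intros)

lemma borel_measurable_expo [measurable]: "expo n \<in> borel_measurable torus"
  by (intro continuous_imp_measurable_on_sets_lebesgue continuous_on_expo) simp

lemma finite_measure_torus: "finite_measure torus"
  by (intro finite_measure_lebesgue_on bounded_set_imp_lmeasurable
      bounded_subset[OF bounded_closed_interval[of 0 1]]) auto

lemma integrable_expo: "integrable torus (expo n)"
  using finite_measure_torus
  by (rule finite_measure.integrable_const_bound[where B = 1]) (simp_all add: cmod_expo)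

lemma integral_expo: "(LINT t|torus. expo n t) = (if n = 0 then 1 else 0)"
proof -
  have "(expo n has_integral (if n = 0 then 1 else 0)) {0..1}"
  proof (cases "n = 0")
    case True
    then show ?thesis
      using has_integral_const_real[of "1::complex" 0 1] by (simp add: expo_def[abs_def])
  next
    case False
    define c where "c = 2 * of_real pi * \<i> * (of_int n :: complex)"
    have "c \<noteq> 0" using False by (simp add: c_def)
    have "((\<lambda>t. exp (c * of_real t) / c) has_vector_derivative exp (c * of_real t)) (at t within {0..1})"
      for t :: real
    proof -
      have "((\<lambda>x. exp (c * x) / c) has_field_derivative exp (c * of_real t)) (at (of_real t))"
        using \<open>c \<noteq> 0\<close> by (auto intro!: derivative_eq_intros)
      from has_vector_derivative_real_field[OF this] show ?thesis .
    qed
    then have "((\<lambda>t. exp (c * of_real t)) has_integral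
        exp (c * of_real 1) / c - exp (c * of_real 0) / c) {0..1}"
      by (intro fundamental_theorem_of_calculus) auto
    moreover have "exp c = 1"
      by (auto simp: c_def exp_eq_1 intro!: exI[of _ n])
    moreover have "expo n = (\<lambda>t. exp (c * of_real t))"
      by (simp add: expo_def c_def fun_eq_iff)
    ultimately show ?thesis using False by simp
  qed
  \<comment> \<open>The fundamental theorem needs the closed interval; \<open>torus\<close> omits
    only the null set \<open>{1}\<close>.\<close>
  then have "(expo n has_integral (if n = 0 then 1 else 0)) {0..<1}"
    by (subst has_integral_spike_set_eq[where T = "{0..1}"])
      (auto intro: negligible_subset[of "{1}"])
  then show ?thesis
    by (subst lebesgue_integral_eq_integral[OF integrable_expo]) (auto simp: integral_unique)
qed

lemma cinner_weighted_exponentials: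
  assumes "square_int g" "square_int w"
  shows "cinner (weighted_exponentials g n) (class_L2 w) = (LINT t|torus. g t * expo n t * cnj (w t))"
  using assms square_int_weighted_exponential[OF assms(1), of n]
  by (simp add: weighted_exponentials_def cinner_L2.abs_eq ae_eq_refl_iff)

lemma norm_weighted_exponentials:
  assumes "square_int g"
  shows "norm (weighted_exponentials g n) = norm (class_L2 g)"
proof -
  have "(norm (weighted_exponentials g n))\<^sup>2 = (norm (class_L2 g))\<^sup>2"
    using assms square_int_weighted_exponential[OF assms, of n]
    by (simp add: weighted_exponentials_def norm_class_L2 norm_mult cmod_expo)
  then show ?thesis by (simp add: power2_eq_iff_nonneg)
qed

text \<open>Together with \<open>norm_weighted_exponentials\<close>, this supplies the positive
  lower bound \<open>c\<close> on the norms of the weighted exponentials.\<close>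

lemma norm_class_L2_pos:
  assumes "square_int g" "AE t in torus. g t \<noteq> 0"
  shows "norm (class_L2 g) > 0"
proof (rule ccontr)
  assume "\<not> ?thesis"
  then have "(LINT t|torus. (cmod (g t))\<^sup>2) = 0"
    using norm_class_L2[OF assms(1)] by simp
  then have "AE t in torus. (cmod (g t))\<^sup>2 = 0"
    using assms(1) by (subst (asm) integral_nonneg_eq_0_iff_AE) (auto simp: square_int_def)
  with assms(2) have "AE t in torus. False" by eventually_elim simp
  then have "emeasure torus (space torus) = 0"
    by (simp add: eventually_False ae_filter_eq_bot_iff)
  then show False by (simp add: emeasure_restrict_space)
qed

section \<open>Nonexistence of a reproducing partner\<close>

theorem corollary3p2:
  fixes g :: "real \<Rightarrow> complex"
  assumes "square_int g"
    and "\<not> quotient_square_int (\<lambda>t. 1) g"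
    and "\<exists>t\<^sub>0\<in>{0..<1::real}. quotient_square_int (\<lambda>t. complex_of_real (t - t\<^sub>0)) g"
  shows "\<not> (\<exists>\<Psi> :: int \<Rightarrow> L2. reproducing_pair \<Psi> (weighted_exponentials g))"
proof
  assume "\<exists>\<Psi> :: int \<Rightarrow> L2. reproducing_pair \<Psi> (weighted_exponentials g)"
  then obtain \<Psi> :: "int \<Rightarrow> L2" where pair: "reproducing_pair \<Psi> (weighted_exponentials g)" ..
  obtain t\<^sub>0 :: real where t\<^sub>0: "t\<^sub>0 \<in> {0..<1}"
    and g0: "AE t in torus. g t \<noteq> 0"
    and q: "square_int (\<lambda>t. complex_of_real (t - t\<^sub>0) / g t)"
    using assms(3) unfolding quotient_square_int_def by blast
  have [measurable]: "g \<in> borel_measurable torus" by (rule square_int_measurable) fact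
  define z where "z t = expo (- 1) (t - t\<^sub>0)" for t
  \<comment> \<open>The conjugation undoes the one in the second argument of \<open>cinner\<close>,
    so that \<open>g\<close> cancels and trigonometric integrals remain.\<close>
  define w where "w k t = cnj ((z t ^ k - 1) / g t)" for k t
  have z_eq: "z t = expo 1 t\<^sub>0 * expo (- 1) t" for t
    by (simp add: z_def expo_diff_right mult.commute)
  have z_meas [measurable]: "z \<in> borel_measurable torus"
    unfolding z_eq[abs_def] by measurable
  have w_sq: "square_int (w k)" for k
    unfolding square_int_def
  proof
    show [measurable]: "w k \<in> borel_measurable torus"
      unfolding w_def by measurable
    have "cmod (w k t) \<le> 2 * pi * real k * cmod (complex_of_real (t - t\<^sub>0) / g t)" for t
    proof -
      have "cmod (z t ^ k - 1) \<le> 2 * pi * real k * \<bar>t - t\<^sub>0\<bar>"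
        using cmod_expo_minus_1_le[of "- int k" "t - t\<^sub>0"] by (simp add: z_def expo_power abs_mult)
      then have "cmod (z t ^ k - 1) / cmod (g t) \<le> 2 * pi * real k * \<bar>t - t\<^sub>0\<bar> / cmod (g t)"
        by (rule divide_right_mono) simp
      then show ?thesis
        by (simp only: w_def complex_mod_cnj norm_divide norm_of_real times_divide_eq_right)
    qed
    then have "(cmod (w k t))\<^sup>2 \<le> (2 * pi * real k * cmod (complex_of_real (t - t\<^sub>0) / g t))\<^sup>2" for t
      by (intro power_mono) auto
    then have bound: "AE t in torus. norm ((cmod (w k t))\<^sup>2)
        \<le> norm ((2 * pi * real k)\<^sup>2 * (cmod (complex_of_real (t - t\<^sub>0) / g t))\<^sup>2)"
      by (intro AE_I2) (simp only: power_mult_distrib real_norm_def abs_mult abs_power2)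
    have "integrable torus (\<lambda>t. (2 * pi * real k)\<^sup>2 * (cmod (complex_of_real (t - t\<^sub>0) / g t))\<^sup>2)"
      using q unfolding square_int_def by (intro integrable_mult_right) simp
    then show "integrable torus (\<lambda>t. (cmod (w k t))\<^sup>2)"
      by (rule Bochner_Integration.integrable_bound[OF _ _ bound]) simp
  qed
  \<comment> \<open>By \<open>z_eq\<close>, \<open>z t ^ k\<close> is the constant phase
    \<open>expo (int k) t\<^sub>0\<close> times \<open>expo (- int k) t\<close>. This phase is the
    \<alpha> of \<open>reproducing_pair_difference_bound\<close>, with \<open>m = 0\<close>.\<close>
  have w_dual: "cinner (weighted_exponentials g n) (class_L2 (w k)) =
      (if n = int k then expo (int k) t\<^sub>0 else 0) - (if n = 0 then 1 else 0)" for n k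
  proof -
    have "cinner (weighted_exponentials g n) (class_L2 (w k)) =
        (LINT t|torus. g t * expo n t * cnj (w k t))"
      by (rule cinner_weighted_exponentials[OF assms(1) w_sq])
    also have "\<dots> = (LINT t|torus. expo (int k) t\<^sub>0 * expo (n - int k) t - expo n t)"
    proof (rule integral_cong_AE)
      show "AE t in torus. g t * expo n t * cnj (w k t)
          = expo (int k) t\<^sub>0 * expo (n - int k) t - expo n t"
        using g0
      proof eventually_elim
        case (elim t)
        then show ?case
          using expo_add[of n "- int k" t]
          by (simp add: w_def z_eq power_mult_distrib expo_power field_simps)
      qed
    qed (use w_sq[THEN square_int_measurable] in measurable)
    also have "\<dots> = (if n = int k then expo (int k) t\<^sub>0 else 0) - (if n = 0 then 1 else 0)"
      by (simp add: Bochner_Integration.integral_diff integrable_expo integral_expo)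
    finally show ?thesis .
  qed
  \<comment> \<open>The bound is uniform in \<open>k\<close> because the constant is chosen before
    \<alpha>, \<open>k\<close>, \<open>m\<close> and \<open>w\<close>.\<close>
  obtain C where C: "\<And>k. norm (class_L2 (w k)) \<le> C"
    using reproducing_pair_difference_bound[OF pair norm_class_L2_pos[OF assms(1) g0]]
      w_dual cmod_expo norm_weighted_exponentials[OF assms(1)]
    by (metis order_refl)
  have eq: "cmod (w k t) = cmod ((z t ^ k - 1) * (1 / g t))" for k t
    by (simp only: w_def complex_mod_cnj) simp
  have "integrable torus (\<lambda>t. (cmod (1 / g t))\<^sup>2)"
  proof (rule integrable_if_rotation_differences_bounded)
    show "AE t in torus. cmod (z t) = 1 \<and> z t \<noteq> 1"
    proof -
      have "AE t in torus. t \<in> {0..<1}" by (rule AE_I2) simp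
      moreover have "AE t in torus. t \<noteq> t\<^sub>0"
        by (auto simp: AE_restrict_space_iff intro: AE_mp[OF AE_completion[OF AE_lborel_singleton]])
      ultimately show ?thesis
      proof eventually_elim
        case (elim t)
        \<comment> \<open>Two distinct points of \<open>{0..<1}\<close> differ by less than 1 in
          absolute value, so \<open>z\<close> takes the value 1 only at
          \<open>t\<^sub>0\<close>.\<close>
        have "t - t\<^sub>0 \<notin> \<int>"
          using elim t\<^sub>0 Ints_nonzero_abs_ge1[of "t - t\<^sub>0"] by auto
        then show ?case
          by (simp add: z_def cmod_expo expo_minus_one_eq_1_iff)
      qed
    qed
    show "integrable torus (\<lambda>t. (cmod ((z t ^ k - 1) * (1 / g t)))\<^sup>2)" for k
      using w_sq[of k] by (simp only: square_int_def eq)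
    show "(LINT t|torus. (cmod ((z t ^ k - 1) * (1 / g t)))\<^sup>2) \<le> C\<^sup>2" for k
      using power_mono[OF C[of k], of 2] by (simp only: norm_class_L2[OF w_sq] eq norm_ge_zero)
  qed measurable
  then have "quotient_square_int (\<lambda>t. 1) g"
    using g0 by (simp add: quotient_square_int_def square_int_def)
  with assms(2) show False ..
qed

end
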